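(* Let $(G,R)$ and $(G',R')$ be cyclically ordered groups, with Rieger unwounds $(uw(G),\leq_R)$ and $(uw(G'),\leq_{R'})$ and distinguished elements $z_G=(1,e)$, $z_{G'}=(1,e')$. Then $(G,R)\equiv(G',R')$ in the language $L_c=\{\cdot,R,e,^{-1}\}$ if and only if $(uw(G),\leq_R,z_G)\equiv(uw(G'),\leq_{R'},z_{G'})$ in the language of ordered groups with one additional constant symbol (interpreted by $z_G$, resp. $z_{G'}$). The same holds for elementary inclusion: if $(G,R)$ is a substructure of $(G',R')$ (so that $uw(G)$ is canonically a substructure of $uw(G')$ and $z_G=z_{G'}$), then $(G,R)$ is an elementary substructure of $(G',R')$ if and only if $(uw(G),\leq_R,z_G)$ is an elementary substructure of $(uw(G'),\leq_{R'},z_{G'})$.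
   Context: A cyclic order on a set $A$ is a ternary relation $R$ such that: $R(x,y,z)$ implies $x,y,z$ pairwise distinct; for pairwise distinct $x,y,z$, $R(x,y,z)$ or $R(x,z,y)$; $R(x,y,z)\Rightarrow R(y,z,x)$; $R(x,y,z)$ and $R(y,u,z)$ imply $R(x,u,z)$. A cyclically ordered group (c.o.g.) $(G,R)$ is a group $G$ with identity $e$ and a cyclic order $R$ on $G$ such that $R(x,y,z)\Rightarrow R(uxv,uyv,uzv)$ for all $u,v$. The Rieger unwound $uw(G)$ of a c.o.g. $(G,R)$ is the set $\mathbb{Z}\times G$ with the order $(m,g)\leq_R(m',g')$ iff $(m,g)=(m',g')$ or $m<m'$ or ($m=m'$ and ($R(e,g,g')$ or $g=e$)), and the group law: $(k,e)\cdot(m,h)=(k+m,h)$, $(k,g)\cdot(m,e)=(k+m,g)$, and for $g,h\neq e$: $(k,g)\cdot(m,h)=(k+m,gh)$ if $R(e,g,gh)$, $=(k+m+1,gh)$ if $R(e,gh,g)$, $=(k+m+1,e)$ if $gh=e$. This is a totally ordered group in which $z_G=(1,e)$ is central and cofinal, and $uw(G)/\langle z_G\rangle\cong G$. *)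

theory Defs
  imports "HOL-Algebra.Group"
begin

section \<open>First-order logic\<close>

datatype 'f fo_term = Var nat | App 'f "'f fo_term list"

datatype ('f, 'r) fo_formula =
    Equal "'f fo_term" "'f fo_term"
  | Atom 'r "'f fo_term list"
  | Neg "('f, 'r) fo_formula"
  | Conj "('f, 'r) fo_formula" "('f, 'r) fo_formula"
  | Exists nat "('f, 'r) fo_formula"

text \<open>The symbols of a language are all elements of the types \<open>'f\<close> and \<open>'r\<close>;
  constants are function symbols of arity 0.\<close>

record ('f, 'r) language =
  fun_arity :: "'f \<Rightarrow> nat"
  rel_arity :: "'r \<Rightarrow> nat"

primrec wf_term :: "('f, 'r) language \<Rightarrow> 'f fo_term \<Rightarrow> bool" where
  "wf_term L (Var x) \<longleftrightarrow> True"
| "wf_term L (App f ts) \<longleftrightarrow> length ts = fun_arity L f \<and> list_all (wf_term L) ts"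

primrec wf_formula :: "('f, 'r) language \<Rightarrow> ('f, 'r) fo_formula \<Rightarrow> bool" where
  "wf_formula L (Equal t u) \<longleftrightarrow> wf_term L t \<and> wf_term L u"
| "wf_formula L (Atom r ts) \<longleftrightarrow> length ts = rel_arity L r \<and> list_all (wf_term L) ts"
| "wf_formula L (Neg \<phi>) \<longleftrightarrow> wf_formula L \<phi>"
| "wf_formula L (Conj \<phi> \<psi>) \<longleftrightarrow> wf_formula L \<phi> \<and> wf_formula L \<psi>"
| "wf_formula L (Exists x \<phi>) \<longleftrightarrow> wf_formula L \<phi>"

primrec term_vars :: "'f fo_term \<Rightarrow> nat set" where
  "term_vars (Var x) = {x}"
| "term_vars (App f ts) = \<Union> (set (map term_vars ts))"

primrec free_vars :: "('f, 'r) fo_formula \<Rightarrow> nat set" where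
  "free_vars (Equal t u) = term_vars t \<union> term_vars u"
| "free_vars (Atom r ts) = \<Union> (set (map term_vars ts))"
| "free_vars (Neg \<phi>) = free_vars \<phi>"
| "free_vars (Conj \<phi> \<psi>) = free_vars \<phi> \<union> free_vars \<psi>"
| "free_vars (Exists x \<phi>) = free_vars \<phi> - {x}"

definition sentence :: "('f, 'r) language \<Rightarrow> ('f, 'r) fo_formula \<Rightarrow> bool" where
  "sentence L \<phi> \<longleftrightarrow> wf_formula L \<phi> \<and> free_vars \<phi> = {}"

text \<open>Interpretations are only relevant on argument lists over \<open>univ\<close> whose length is the
  arity of the symbol.\<close>

record ('f, 'r, 'a) fo_structure =
  univ :: "'a set"
  fun_interp :: "'f \<Rightarrow> 'a list \<Rightarrow> 'a"
  rel_interp :: "'r \<Rightarrow> 'a list \<Rightarrow> bool"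

primrec term_val :: "('f, 'r, 'a) fo_structure \<Rightarrow> (nat \<Rightarrow> 'a) \<Rightarrow> 'f fo_term \<Rightarrow> 'a" where
  "term_val M s (Var x) = s x"
| "term_val M s (App f ts) = fun_interp M f (map (term_val M s) ts)"

primrec sat :: "('f, 'r, 'a) fo_structure \<Rightarrow> (nat \<Rightarrow> 'a) \<Rightarrow> ('f, 'r) fo_formula \<Rightarrow> bool" where
  "sat M s (Equal t u) \<longleftrightarrow> term_val M s t = term_val M s u"
| "sat M s (Atom r ts) \<longleftrightarrow> rel_interp M r (map (term_val M s) ts)"
| "sat M s (Neg \<phi>) \<longleftrightarrow> \<not> sat M s \<phi>"
| "sat M s (Conj \<phi> \<psi>) \<longleftrightarrow> sat M s \<phi> \<and> sat M s \<psi>"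
| "sat M s (Exists x \<phi>) \<longleftrightarrow> (\<exists>a \<in> univ M. sat M (s(x := a)) \<phi>)"

definition assignment :: "('f, 'r, 'a) fo_structure \<Rightarrow> (nat \<Rightarrow> 'a) \<Rightarrow> bool" where
  "assignment M s \<longleftrightarrow> (\<forall>x. s x \<in> univ M)"

definition models :: "('f, 'r, 'a) fo_structure \<Rightarrow> ('f, 'r) fo_formula \<Rightarrow> bool" where
  "models M \<phi> \<longleftrightarrow> (\<forall>s. assignment M s \<longrightarrow> sat M s \<phi>)"

definition elem_equiv ::
  "('f, 'r) language \<Rightarrow> ('f, 'r, 'a) fo_structure \<Rightarrow> ('f, 'r, 'b) fo_structure \<Rightarrow> bool" where
  "elem_equiv L M N \<longleftrightarrow> (\<forall>\<phi>. sentence L \<phi> \<longrightarrow> (models M \<phi> \<longleftrightarrow> models N \<phi>))"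

definition substructure ::
  "('f, 'r) language \<Rightarrow> ('f, 'r, 'a) fo_structure \<Rightarrow> ('f, 'r, 'a) fo_structure \<Rightarrow> bool" where
  "substructure L M N \<longleftrightarrow>
     univ M \<subseteq> univ N \<and>
     (\<forall>f xs. set xs \<subseteq> univ M \<and> length xs = fun_arity L f \<longrightarrow>
        fun_interp M f xs = fun_interp N f xs) \<and>
     (\<forall>r xs. set xs \<subseteq> univ M \<and> length xs = rel_arity L r \<longrightarrow>
        (rel_interp M r xs \<longleftrightarrow> rel_interp N r xs))"

definition elem_substructure ::
  "('f, 'r) language \<Rightarrow> ('f, 'r, 'a) fo_structure \<Rightarrow> ('f, 'r, 'a) fo_structure \<Rightarrow> bool" where
  "elem_substructure L M N \<longleftrightarrow>
     substructure L M N \<and>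
     (\<forall>\<phi> s. wf_formula L \<phi> \<and> assignment M s \<longrightarrow> (sat M s \<phi> \<longleftrightarrow> sat N s \<phi>))"


section \<open>Cyclically ordered groups\<close>

definition cyclic_order_on :: "'a set \<Rightarrow> ('a \<Rightarrow> 'a \<Rightarrow> 'a \<Rightarrow> bool) \<Rightarrow> bool" where
  "cyclic_order_on A R \<longleftrightarrow>
     (\<forall>x\<in>A. \<forall>y\<in>A. \<forall>z\<in>A. R x y z \<longrightarrow> x \<noteq> y \<and> y \<noteq> z \<and> x \<noteq> z) \<and>
     (\<forall>x\<in>A. \<forall>y\<in>A. \<forall>z\<in>A. x \<noteq> y \<and> y \<noteq> z \<and> x \<noteq> z \<longrightarrow> R x y z \<or> R x z y) \<and>
     (\<forall>x\<in>A. \<forall>y\<in>A. \<forall>z\<in>A. R x y z \<longrightarrow> R y z x) \<and>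
     (\<forall>x\<in>A. \<forall>y\<in>A. \<forall>z\<in>A. \<forall>u\<in>A. R x y z \<and> R y u z \<longrightarrow> R x u z)"

locale cyclically_ordered_group = group G for G (structure) +
  fixes R :: "'a \<Rightarrow> 'a \<Rightarrow> 'a \<Rightarrow> bool"
  assumes cyclic_order: "cyclic_order_on (carrier G) R"
    and compatible:
      "\<lbrakk>x \<in> carrier G; y \<in> carrier G; z \<in> carrier G; u \<in> carrier G; v \<in> carrier G; R x y z\<rbrakk>
        \<Longrightarrow> R (u \<otimes> x \<otimes> v) (u \<otimes> y \<otimes> v) (u \<otimes> z \<otimes> v)"

datatype cog_fun = CMult | COne | CInv
datatype cog_rel = CCyc

definition L_c :: "(cog_fun, cog_rel) language" where
  "L_c = \<lparr>fun_arity = (\<lambda>f. case f of CMult \<Rightarrow> 2 | COne \<Rightarrow> 0 | CInv \<Rightarrow> 1),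
          rel_arity = (\<lambda>_. 3)\<rparr>"

definition cog_structure ::
  "'a monoid \<Rightarrow> ('a \<Rightarrow> 'a \<Rightarrow> 'a \<Rightarrow> bool) \<Rightarrow> (cog_fun, cog_rel, 'a) fo_structure" where
  "cog_structure G R =
     \<lparr>univ = carrier G,
      fun_interp = (\<lambda>f xs. case f of
          CMult \<Rightarrow> (xs ! 0) \<otimes>\<^bsub>G\<^esub> (xs ! 1)
        | COne \<Rightarrow> \<one>\<^bsub>G\<^esub>
        | CInv \<Rightarrow> inv\<^bsub>G\<^esub> (xs ! 0)),
      rel_interp = (\<lambda>_ xs. R (xs ! 0) (xs ! 1) (xs ! 2))\<rparr>"


section \<open>The Rieger unwound\<close>

text \<open>In a cyclically ordered group the last branch of \<open>uw_mult\<close> is reached exactly when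
  \<open>g\<close> and \<open>h\<close> are mutually inverse and different from the identity.\<close>

definition uw_mult ::
  "'a monoid \<Rightarrow> ('a \<Rightarrow> 'a \<Rightarrow> 'a \<Rightarrow> bool) \<Rightarrow> int \<times> 'a \<Rightarrow> int \<times> 'a \<Rightarrow> int \<times> 'a" where
  "uw_mult G R = (\<lambda>(k, g) (m, h).
     if g = \<one>\<^bsub>G\<^esub> then (k + m, h)
     else if h = \<one>\<^bsub>G\<^esub> then (k + m, g)
     else if R \<one>\<^bsub>G\<^esub> g (g \<otimes>\<^bsub>G\<^esub> h) then (k + m, g \<otimes>\<^bsub>G\<^esub> h)
     else if R \<one>\<^bsub>G\<^esub> (g \<otimes>\<^bsub>G\<^esub> h) g then (k + m + 1, g \<otimes>\<^bsub>G\<^esub> h)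
     else (k + m + 1, \<one>\<^bsub>G\<^esub>))"

definition uw :: "'a monoid \<Rightarrow> ('a \<Rightarrow> 'a \<Rightarrow> 'a \<Rightarrow> bool) \<Rightarrow> (int \<times> 'a) monoid" where
  "uw G R = \<lparr>carrier = UNIV \<times> carrier G, mult = uw_mult G R, one = (0, \<one>\<^bsub>G\<^esub>)\<rparr>"

definition uw_le ::
  "'a monoid \<Rightarrow> ('a \<Rightarrow> 'a \<Rightarrow> 'a \<Rightarrow> bool) \<Rightarrow> int \<times> 'a \<Rightarrow> int \<times> 'a \<Rightarrow> bool" where
  "uw_le G R = (\<lambda>(m, g) (m', g').
     (m, g) = (m', g') \<or> m < m' \<or> (m = m' \<and> (R \<one>\<^bsub>G\<^esub> g g' \<or> g = \<one>\<^bsub>G\<^esub>)))"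

definition uw_z :: "'a monoid \<Rightarrow> int \<times> 'a" where
  "uw_z G = (1, \<one>\<^bsub>G\<^esub>)"

datatype ogz_fun = OMult | OOne | OInv | OConst
datatype ogz_rel = OLe

definition L_ogz :: "(ogz_fun, ogz_rel) language" where
  "L_ogz = \<lparr>fun_arity = (\<lambda>f. case f of OMult \<Rightarrow> 2 | OOne \<Rightarrow> 0 | OInv \<Rightarrow> 1 | OConst \<Rightarrow> 0),
            rel_arity = (\<lambda>_. 2)\<rparr>"

definition ogz_structure ::
  "'a monoid \<Rightarrow> ('a \<Rightarrow> 'a \<Rightarrow> bool) \<Rightarrow> 'a \<Rightarrow> (ogz_fun, ogz_rel, 'a) fo_structure" where
  "ogz_structure H leq z =
     \<lparr>univ = carrier H,
      fun_interp = (\<lambda>f xs. case f of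
          OMult \<Rightarrow> (xs ! 0) \<otimes>\<^bsub>H\<^esub> (xs ! 1)
        | OOne \<Rightarrow> \<one>\<^bsub>H\<^esub>
        | OInv \<Rightarrow> inv\<^bsub>H\<^esub> (xs ! 0)
        | OConst \<Rightarrow> z),
      rel_interp = (\<lambda>_ xs. leq (xs ! 0) (xs ! 1))\<rparr>"

definition uw_structure ::
  "'a monoid \<Rightarrow> ('a \<Rightarrow> 'a \<Rightarrow> 'a \<Rightarrow> bool) \<Rightarrow> (ogz_fun, ogz_rel, int \<times> 'a) fo_structure" where
  "uw_structure G R = ogz_structure (uw G R) (uw_le G R) (uw_z G)"

end

theory Submission
  imports Defs
begin

text \<open>
  Since the integers are the same for all groups, \<open>\<int> \<times> G\<close> can be treated in the manner of
  Feferman and Vaught: a formula about pairs \<open>(k, g)\<close> is equivalent to a finite disjunction of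
  conjunctions of an \<^emph>\<open>arbitrary\<close> condition on the integer parts \<open>k\<close> and an \<open>L_c\<close> formula on the
  group parts \<open>g\<close>, and both the conditions and the formulas are independent of \<open>G\<close>. This works
  for atomic formulas because a term has as group part the value of the corresponding \<open>L_c\<close> term,
  while its integer part is a function of the \<open>k\<close>'s up to finitely many carries that are definable
  in \<open>G\<close>; and an existential quantifier over \<open>\<int> \<times> G\<close> distributes over such disjunctions.

  Conversely, \<open>G\<close> is interpreted in its unwound as the interval \<open>[e, z)\<close>, with multiplication
  corrected by a power of \<open>z\<close> and with \<open>R x y w\<close> expressing that \<open>x < y < w\<close> up to a cyclic
  permutation.
\<close>

section \<open>Satisfaction and sentences\<close>

lemma term_val_cong:
  "(\<And>x. x \<in> term_vars t \<Longrightarrow> s x = s' x) \<Longrightarrow> term_val M s t = term_val M s' t"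
proof (induction t)
  case (App f ts)
  then have "map (term_val M s) ts = map (term_val M s') ts"
    by auto
  then show ?case by (metis term_val.simps(2))
qed simp

lemma sat_cong:
  "(\<And>x. x \<in> free_vars \<phi> \<Longrightarrow> s x = s' x) \<Longrightarrow> sat M s \<phi> \<longleftrightarrow> sat M s' \<phi>"
proof (induction \<phi> arbitrary: s s')
  case (Equal t u)
  then show ?case
    using term_val_cong[of t s s' M] term_val_cong[of u s s' M] by auto
next
  case (Atom r ts)
  then have "map (term_val M s) ts = map (term_val M s') ts"
    by (auto intro!: term_val_cong)
  then show ?case by (metis sat.simps(2))
next
  case (Neg \<phi>)
  from Neg.IH[of s s'] Neg.prems show ?case by simp
next
  case (Conj \<phi> \<psi>)
  from Conj.IH(1)[of s s'] Conj.IH(2)[of s s'] Conj.prems show ?case by simp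
next
  case (Exists x \<phi>)
  have "sat M (s(x := a)) \<phi> \<longleftrightarrow> sat M (s'(x := a)) \<phi>" for a
    using Exists.prems by (intro Exists.IH) auto
  then show ?case by simp
qed

text \<open>By \<open>sat_cong\<close> the truth of a sentence does not depend on the assignment, so
  a single assignment decides \<open>models\<close>.\<close>

lemma models_sentence_iff:
  "sentence L \<phi> \<Longrightarrow> assignment M s \<Longrightarrow> models M \<phi> \<longleftrightarrow> sat M s \<phi>"
  unfolding models_def sentence_def using sat_cong[of \<phi> _ s M] by blast

definition Disj :: "('f, 'r) fo_formula \<Rightarrow> ('f, 'r) fo_formula \<Rightarrow> ('f, 'r) fo_formula" where
  "Disj \<phi> \<psi> = Neg (Conj (Neg \<phi>) (Neg \<psi>))"

lemma Disj_simps [simp]: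
  "sat M s (Disj \<phi> \<psi>) \<longleftrightarrow> sat M s \<phi> \<or> sat M s \<psi>"
  "wf_formula L (Disj \<phi> \<psi>) \<longleftrightarrow> wf_formula L \<phi> \<and> wf_formula L \<psi>"
  "free_vars (Disj \<phi> \<psi>) = free_vars \<phi> \<union> free_vars \<psi>"
  by (auto simp: Disj_def)

lemma sat_foldr_Disj:
  "sat M s (foldr Disj \<phi>s \<psi>) \<longleftrightarrow> (\<exists>\<phi>\<in>set \<phi>s. sat M s \<phi>) \<or> sat M s \<psi>"
  by (induction \<phi>s) auto

lemma wf_foldr_Disj:
  "wf_formula L (foldr Disj \<phi>s \<psi>) \<longleftrightarrow> (\<forall>\<phi>\<in>set \<phi>s. wf_formula L \<phi>) \<and> wf_formula L \<psi>"
  by (induction \<phi>s) auto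

lemma free_vars_foldr_Disj:
  "free_vars (foldr Disj \<phi>s \<psi>) = (\<Union>\<phi>\<in>set \<phi>s. free_vars \<phi>) \<union> free_vars \<psi>"
  by (induction \<phi>s) auto

lemma length_2_cases:
  assumes "length xs = 2" obtains x y where "xs = [x, y]"
  using assms by (auto simp: numeral_2_eq_2 length_Suc_conv)

lemma length_3_cases:
  assumes "length xs = 3" obtains x y z where "xs = [x, y, z]"
  using assms by (auto simp: numeral_3_eq_3 length_Suc_conv)


section \<open>The unwound of a cyclically ordered group\<close>

text \<open>The cocycle of the unwound as a central extension of \<open>G\<close> by the integers.
  The two branches of \<open>uw_mult\<close> that raise the integer part are merged: a product that
  passes the identity and one that hits it exactly both carry 1.\<close>

definition uw_carry :: "'a monoid \<Rightarrow> ('a \<Rightarrow> 'a \<Rightarrow> 'a \<Rightarrow> bool) \<Rightarrow> 'a \<Rightarrow> 'a \<Rightarrow> int" where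
  "uw_carry G R g h =
     (if g \<noteq> \<one>\<^bsub>G\<^esub> \<and> h \<noteq> \<one>\<^bsub>G\<^esub> \<and> \<not> R \<one>\<^bsub>G\<^esub> g (g \<otimes>\<^bsub>G\<^esub> h) then 1 else 0)"

lemma cog_structure_simps [simp]:
  "univ (cog_structure G R) = carrier G"
  "fun_interp (cog_structure G R) CMult xs = xs ! 0 \<otimes>\<^bsub>G\<^esub> xs ! 1"
  "fun_interp (cog_structure G R) COne xs = \<one>\<^bsub>G\<^esub>"
  "fun_interp (cog_structure G R) CInv xs = inv\<^bsub>G\<^esub> (xs ! 0)"
  "rel_interp (cog_structure G R) r xs \<longleftrightarrow> R (xs ! 0) (xs ! 1) (xs ! 2)"
  by (simp_all add: cog_structure_def)

lemma L_c_simps [simp]: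
  "fun_arity L_c CMult = 2" "fun_arity L_c COne = 0" "fun_arity L_c CInv = 1"
  "rel_arity L_c r = 3"
  by (simp_all add: L_c_def)

lemma L_ogz_simps [simp]:
  "fun_arity L_ogz OMult = 2" "fun_arity L_ogz OOne = 0" "fun_arity L_ogz OInv = 1"
  "fun_arity L_ogz OConst = 0" "rel_arity L_ogz q = 2"
  by (simp_all add: L_ogz_def)

lemma uw_structure_simps [simp]:
  "univ (uw_structure G R) = UNIV \<times> carrier G"
  "fun_interp (uw_structure G R) OMult xs = uw_mult G R (xs ! 0) (xs ! 1)"
  "fun_interp (uw_structure G R) OOne xs = (0, \<one>\<^bsub>G\<^esub>)"
  "fun_interp (uw_structure G R) OInv xs = inv\<^bsub>uw G R\<^esub> (xs ! 0)"
  "fun_interp (uw_structure G R) OConst xs = (1, \<one>\<^bsub>G\<^esub>)"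
  "rel_interp (uw_structure G R) q xs \<longleftrightarrow> uw_le G R (xs ! 0) (xs ! 1)"
  by (simp_all add: uw_structure_def ogz_structure_def uw_def uw_z_def)

lemma assignment_cog: "assignment (cog_structure G R) s \<longleftrightarrow> (\<forall>x. s x \<in> carrier G)"
  by (simp add: assignment_def)

lemma assignment_uw: "assignment (uw_structure G R) s \<longleftrightarrow> (\<forall>x. snd (s x) \<in> carrier G)"
  by (simp add: assignment_def mem_Times_iff)

section \<open>Cutting a cyclic order at the identity\<close>

context cyclically_ordered_group
begin

lemma R_distinct:
  "R x y z \<Longrightarrow> x \<in> carrier G \<Longrightarrow> y \<in> carrier G \<Longrightarrow> z \<in> carrier G \<Longrightarrow> x \<noteq> y \<and> y \<noteq> z \<and> x \<noteq> z"
  using cyclic_order unfolding cyclic_order_on_def by blast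

lemma R_total:
  "x \<in> carrier G \<Longrightarrow> y \<in> carrier G \<Longrightarrow> z \<in> carrier G \<Longrightarrow> x \<noteq> y \<Longrightarrow> y \<noteq> z \<Longrightarrow> x \<noteq> z
    \<Longrightarrow> R x y z \<or> R x z y"
  using cyclic_order unfolding cyclic_order_on_def by blast

lemma R_rotate:
  "R x y z \<Longrightarrow> x \<in> carrier G \<Longrightarrow> y \<in> carrier G \<Longrightarrow> z \<in> carrier G \<Longrightarrow> R y z x"
  using cyclic_order unfolding cyclic_order_on_def by blast

lemma R_trans:
  "R x y z \<Longrightarrow> R y u z \<Longrightarrow> x \<in> carrier G \<Longrightarrow> y \<in> carrier G \<Longrightarrow> z \<in> carrier G
    \<Longrightarrow> u \<in> carrier G \<Longrightarrow> R x u z"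
  using cyclic_order unfolding cyclic_order_on_def by blast

text \<open>Rotating \<open>R x z y\<close> gives \<open>R y x z\<close>, and transitivity with the
  fourth point equal to \<open>x\<close> then yields \<open>R x x z\<close>, against
  distinctness.\<close>

lemma R_asym:
  assumes "R x y z" "x \<in> carrier G" "y \<in> carrier G" "z \<in> carrier G"
  shows "\<not> R x z y"
proof
  assume "R x z y"
  then have "R y x z"
    using assms(2-) R_rotate by blast
  with assms have "R x x z"
    using R_trans by blast
  with assms show False
    using R_distinct by blast
qed

text \<open>The strict linear order on \<open>G\<close> obtained by cutting the circle at the
  identity, which becomes the least element. It is the strict part of \<open>uw_le\<close> on pairs
  with equal integer parts.\<close>

definition less_cut :: "'a \<Rightarrow> 'a \<Rightarrow> bool" where
  "less_cut x y \<longleftrightarrow> x \<noteq> y \<and> (x = \<one> \<or> R \<one> x y)"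

text \<open>If \<open>x\<close> is not the identity, then \<open>R z \<one> y\<close> holds by
  rotation, and transitivity replaces \<open>\<one>\<close> by \<open>x\<close>, which lies between
  \<open>\<one>\<close> and \<open>y\<close>.\<close>

lemma less_cut_imp_R:
  assumes "less_cut x y" "less_cut y z" "x \<in> carrier G" "y \<in> carrier G" "z \<in> carrier G"
  shows "R x y z"
proof (cases "x = \<one>")
  case True
  with assms show ?thesis by (auto simp: less_cut_def)
next
  case False
  with assms have xy: "R \<one> x y"
    by (simp add: less_cut_def)
  with assms have "y \<noteq> \<one>"
    using R_distinct by blast
  with assms have "R \<one> y z"
    by (simp add: less_cut_def)
  with assms have "R z \<one> y"
    using R_rotate by blast
  with xy assms have "R z x y"
    using R_trans by blast
  with assms show ?thesis
    using R_rotate by blast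
qed

lemma less_cut_total:
  "x \<in> carrier G \<Longrightarrow> y \<in> carrier G \<Longrightarrow> x \<noteq> y \<Longrightarrow> less_cut x y \<or> less_cut y x"
  using R_total[of \<one> x y] by (auto simp: less_cut_def)

text \<open>The cut loses no information. Three distinct points occur in one of six linear orders;
  three of them are rotations of \<open>x, y, z\<close>, and the other three give
  \<open>R x z y\<close>, which asymmetry excludes. This makes \<open>R\<close> definable from the
  order of the unwound.\<close>

lemma R_iff_less_cut:
  assumes "x \<in> carrier G" "y \<in> carrier G" "z \<in> carrier G"
  shows "R x y z \<longleftrightarrow>
    less_cut x y \<and> less_cut y z \<or> less_cut y z \<and> less_cut z x \<or> less_cut z x \<and> less_cut x y"
    (is "_ \<longleftrightarrow> ?cyc x y z")
proof
  assume R: "R x y z"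
  then have "x \<noteq> y" "y \<noteq> z" "x \<noteq> z"
    using R_distinct assms by blast+
  then have "less_cut x y \<or> less_cut y x" "less_cut y z \<or> less_cut z y" "less_cut z x \<or> less_cut x z"
    using less_cut_total assms by blast+
  then have "?cyc x y z \<or> ?cyc x z y"
    by blast
  moreover have "\<not> ?cyc x z y"
    using R_asym[OF R] less_cut_imp_R R_rotate assms by meson
  ultimately show "?cyc x y z" by blast
next
  assume "?cyc x y z"
  then show "R x y z"
    using less_cut_imp_R R_rotate assms by meson
qed

end

text \<open>The unwound is only defined for plain monoid records.\<close>

locale unwound_cog = cyclically_ordered_group G R
  for G :: "'a monoid" (structure) and R

section \<open>Product and inverse in the unwound\<close>

context unwound_cog
begin

text \<open>If neither factor is the identity, then \<open>g \<otimes> h\<close> differs from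
  \<open>g\<close>, so exactly one of \<open>R \<one> g (g \<otimes> h)\<close>,
  \<open>R \<one> (g \<otimes> h) g\<close> and \<open>g \<otimes> h = \<one>\<close> holds. These
  are the last three branches of \<open>uw_mult\<close>, with carries 0, 1 and 1.\<close>

lemma uw_mult_eq:
  assumes "g \<in> carrier G" "h \<in> carrier G"
  shows "uw_mult G R (k, g) (m, h) = (k + m + uw_carry G R g h, g \<otimes> h)"
proof (cases "g = \<one> \<or> h = \<one>")
  case True
  with assms show ?thesis by (auto simp: uw_mult_def uw_carry_def)
next
  case False
  with assms have "g \<otimes> h \<noteq> g"
    by simp
  with False assms have "g \<otimes> h = \<one> \<or> R \<one> g (g \<otimes> h) \<or> R \<one> (g \<otimes> h) g"
    using R_total[of \<one> g "g \<otimes> h"] by auto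
  moreover have "\<not> (R \<one> g (g \<otimes> h) \<and> R \<one> (g \<otimes> h) g)"
    using R_asym[of \<one> g "g \<otimes> h"] assms by auto
  moreover have "\<not> R \<one> g \<one>" "\<not> R \<one> \<one> g"
    using R_distinct assms by blast+
  ultimately show ?thesis
    using False by (auto simp: uw_mult_def uw_carry_def)
qed

text \<open>For \<open>g\<close> different from the identity, \<open>g\<close> and
  \<open>inv g\<close> carry 1 in either order, and the extra \<open>- 1\<close> cancels it. The
  definite description behind the inverse is evaluated directly: the group parts force
  \<open>h = inv g\<close>, and then the integer parts determine \<open>m\<close>.\<close>

lemma uw_inv_eq:
  assumes "g \<in> carrier G"
  shows "inv\<^bsub>uw G R\<^esub> (k, g) = (if g = \<one> then - k else - k - 1, inv g)"
proof -
  have carry: "uw_carry G R g (inv g) = (if g = \<one> then 0 else 1)"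
      "uw_carry G R (inv g) g = (if g = \<one> then 0 else 1)"
    using assms R_distinct[of \<one> g \<one>] R_distinct[of \<one> "inv g" \<one>]
    by (auto simp: uw_carry_def)
  show ?thesis
    unfolding m_inv_def[of "uw G R"]
  proof (rule the_equality)
    show "(if g = \<one> then - k else - k - 1, inv g) \<in> carrier (uw G R) \<and>
      (k, g) \<otimes>\<^bsub>uw G R\<^esub> (if g = \<one> then - k else - k - 1, inv g) = \<one>\<^bsub>uw G R\<^esub> \<and>
      (if g = \<one> then - k else - k - 1, inv g) \<otimes>\<^bsub>uw G R\<^esub> (k, g) = \<one>\<^bsub>uw G R\<^esub>"
      using assms carry by (auto simp: uw_def uw_mult_eq)
  next
    fix y assume y: "y \<in> carrier (uw G R) \<and> (k, g) \<otimes>\<^bsub>uw G R\<^esub> y = \<one>\<^bsub>uw G R\<^esub> \<and>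
      y \<otimes>\<^bsub>uw G R\<^esub> (k, g) = \<one>\<^bsub>uw G R\<^esub>"
    obtain m h where yeq: "y = (m, h)" by (cases y)
    with y have h: "h \<in> carrier G"
      by (simp add: uw_def)
    from y have *: "k + m + uw_carry G R g h = 0" "h \<otimes> g = \<one>"
      using assms h by (auto simp: uw_def uw_mult_eq yeq)
    then have "h = inv g"
      using assms h inv_equality by auto
    with * carry show "y = (if g = \<one> then - k else - k - 1, inv g)"
      by (auto simp: yeq split: if_splits)
  qed
qed

end


section \<open>Splitting formulas about the unwound\<close>

abbreviation cOne :: "cog_fun fo_term" where "cOne \<equiv> App COne []"
abbreviation cMult :: "cog_fun fo_term \<Rightarrow> cog_fun fo_term \<Rightarrow> cog_fun fo_term" where
  "cMult t u \<equiv> App CMult [t, u]"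
abbreviation cTrue :: "(cog_fun, cog_rel) fo_formula" where "cTrue \<equiv> Equal cOne cOne"

text \<open>The syntactic counterpart of the projection from the unwound to \<open>G\<close>. The
  constant becomes the identity because \<open>z\<close> lies in the kernel.\<close>

primrec cog_term :: "ogz_fun fo_term \<Rightarrow> cog_fun fo_term" where
  "cog_term (Var x) = Var x"
| "cog_term (App f ts) = (case f of
      OMult \<Rightarrow> App CMult (map cog_term ts)
    | OOne \<Rightarrow> cOne
    | OInv \<Rightarrow> App CInv (map cog_term ts)
    | OConst \<Rightarrow> cOne)"

text \<open>The case distinction of \<open>uw_carry\<close> written in \<open>L_c\<close>, each case
  tagged with its carry. Since the second formula negates the first, exactly one holds under any
  assignment.\<close>

definition carry_cases ::
  "cog_fun fo_term \<Rightarrow> cog_fun fo_term \<Rightarrow> (int \<times> (cog_fun, cog_rel) fo_formula) list" where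
  "carry_cases t u =
     (let \<gamma> = Conj (Conj (Neg (Equal t cOne)) (Neg (Equal u cOne)))
                (Neg (Atom CCyc [cOne, t, cMult t u]))
      in [(1, \<gamma>), (0, Neg \<gamma>)])"

text \<open>Every \<open>(F, \<beta>)\<close> in \<open>winding t\<close> says that the integer part of \<open>t\<close> is \<open>F\<close> of the integer parts
  of the variables whenever the group parts satisfy \<open>\<beta>\<close>; the \<open>\<beta>\<close>'s cover all cases.\<close>

primrec winding ::
  "ogz_fun fo_term \<Rightarrow> (((nat \<Rightarrow> int) \<Rightarrow> int) \<times> (cog_fun, cog_rel) fo_formula) list" where
  "winding (Var x) = [(\<lambda>k. k x, cTrue)]"
| "winding (App f ts) =
    (let ws = map winding ts; us = map cog_term ts in case f of
      OMult \<Rightarrow> [(\<lambda>k. F k + F' k + c, Conj (Conj \<beta> \<beta>') \<gamma>).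
                 (F, \<beta>) \<leftarrow> ws ! 0, (F', \<beta>') \<leftarrow> ws ! 1, (c, \<gamma>) \<leftarrow> carry_cases (us ! 0) (us ! 1)]
    | OOne \<Rightarrow> [(\<lambda>_. 0, cTrue)]
    | OInv \<Rightarrow> [(\<lambda>k. - F k, Conj \<beta> (Equal (us ! 0) cOne)). (F, \<beta>) \<leftarrow> ws ! 0] @
              [(\<lambda>k. - F k - 1, Conj \<beta> (Neg (Equal (us ! 0) cOne))). (F, \<beta>) \<leftarrow> ws ! 0]
    | OConst \<Rightarrow> [(\<lambda>_. 1, cTrue)])"

lemma cog_term_wf: "wf_term L_ogz t \<Longrightarrow> wf_term L_c (cog_term t)"
  by (induction t) (auto simp: list_all_iff split: ogz_fun.split)

lemma cog_term_vars: "term_vars (cog_term t) \<subseteq> term_vars t"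
  by (induction t) (auto split: ogz_fun.split)

lemma carry_cases_wf:
  "(c, \<gamma>) \<in> set (carry_cases t u) \<Longrightarrow> wf_term L_c t \<Longrightarrow> wf_term L_c u \<Longrightarrow>
    wf_formula L_c \<gamma> \<and> free_vars \<gamma> \<subseteq> term_vars t \<union> term_vars u"
  by (auto simp: carry_cases_def Let_def)

lemma winding_wf:
  "wf_term L_ogz t \<Longrightarrow> (F, \<beta>) \<in> set (winding t) \<Longrightarrow>
    wf_formula L_c \<beta> \<and> free_vars \<beta> \<subseteq> term_vars t"
proof (induction t arbitrary: F \<beta>)
  case (App f ts)
  show ?case
  proof (cases f)
    case OMult
    with App.prems obtain t u where ts: "ts = [t, u]"
      by (auto elim: length_2_cases)
    from App.prems OMult ts obtain F1 \<beta>1 F2 \<beta>2 c \<gamma> where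
      *: "(F1, \<beta>1) \<in> set (winding t)" "(F2, \<beta>2) \<in> set (winding u)"
        "(c, \<gamma>) \<in> set (carry_cases (cog_term t) (cog_term u))"
        "\<beta> = Conj (Conj \<beta>1 \<beta>2) \<gamma>"
      by auto
    from App.prems OMult ts have "wf_term L_ogz t" "wf_term L_ogz u" by auto
    with carry_cases_wf[OF *(3)] cog_term_wf have
      "wf_formula L_c \<gamma> \<and> free_vars \<gamma> \<subseteq> term_vars (cog_term t) \<union> term_vars (cog_term u)"
      by blast
    with * App.IH[of t F1 \<beta>1] App.IH[of u F2 \<beta>2] App.prems ts cog_term_vars[of t] cog_term_vars[of u]
    show ?thesis by auto
  next
    case OInv
    with App.prems obtain t where ts: "ts = [t]"
      by (auto simp: length_Suc_conv)
    from App.prems OInv ts have t: "wf_term L_ogz t" by auto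
    from App.prems OInv ts obtain F1 \<beta>1 where
      "(F1, \<beta>1) \<in> set (winding t)"
      "\<beta> = Conj \<beta>1 (Equal (cog_term t) cOne) \<or> \<beta> = Conj \<beta>1 (Neg (Equal (cog_term t) cOne))"
      by auto
    with App.IH[of t F1 \<beta>1] t ts cog_term_vars[of t] cog_term_wf[of t]
    show ?thesis by auto
  qed (use App.prems in auto)
qed auto

section \<open>Group parts and integer parts of term values\<close>

context unwound_cog
begin

abbreviation M where "M \<equiv> cog_structure G R"
abbreviation U where "U \<equiv> uw_structure G R"

lemma cog_term_val_closed:
  "wf_term L_c t \<Longrightarrow> assignment M s \<Longrightarrow> term_val M s t \<in> carrier G"
proof (induction t)
  case (App f ts)
  show ?case
    by (cases f) (use App in \<open>auto simp: list_all_iff length_Suc_conv elim: length_2_cases\<close>)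
qed (simp add: assignment_cog)

lemma snd_assignment: "assignment U s \<Longrightarrow> assignment M (\<lambda>x. snd (s x))"
  by (simp add: assignment_uw assignment_cog)

lemma sat_carry_cases:
  assumes "c = uw_carry G R (term_val M g t) (term_val M g u)"
  shows "\<exists>r \<in> set (carry_cases t u). sat M g (snd r)"
    and "r \<in> set (carry_cases t u) \<Longrightarrow> sat M g (snd r) \<Longrightarrow> fst r = c"
  by (auto simp: assms carry_cases_def Let_def uw_carry_def split: if_splits)

text \<open>The projection to \<open>G\<close> respects product, inverse and constants. The
  induction also needs the group parts of the arguments to lie in the carrier, since the formulas
  for product and inverse hold only there.\<close>

lemma snd_term_val:
  "wf_term L_ogz t \<Longrightarrow> assignment U s \<Longrightarrow>
    snd (term_val U s t) = term_val M (\<lambda>x. snd (s x)) (cog_term t)"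
proof (induction t)
  case (App f ts)
  have closed: "snd (term_val U s t) \<in> carrier G" if "t \<in> set ts" for t
    using App.IH[OF that] App.prems that cog_term_val_closed[OF cog_term_wf snd_assignment]
    by (auto simp: list_all_iff)
  show ?case
  proof (cases f)
    case OMult
    with App.prems obtain t u where ts: "ts = [t, u]"
      by (auto elim: length_2_cases)
    with App.prems OMult App.IH[of t] App.IH[of u] closed[of t] closed[of u] show ?thesis
      by (cases "term_val U s t"; cases "term_val U s u") (simp add: uw_mult_eq)
  next
    case OInv
    with App.prems obtain t where ts: "ts = [t]"
      by (auto simp: length_Suc_conv)
    with App.prems OInv App.IH[of t] closed[of t] show ?thesis
      by (cases "term_val U s t") (simp add: uw_inv_eq)
  qed auto
qed simp

lemma snd_term_val_closed:
  "wf_term L_ogz t \<Longrightarrow> assignment U s \<Longrightarrow> snd (term_val U s t) \<in> carrier G"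
  using snd_term_val cog_term_val_closed cog_term_wf snd_assignment by metis

text \<open>These are the two properties announced for \<open>winding\<close>: the cases cover
  everything, and each case that holds is correct. The carry of a product depends only on the group
  parts of the factors, which \<open>snd_term_val\<close> identifies with values of
  \<open>L_c\<close> terms, so \<open>carry_cases\<close> can detect it inside
  \<open>G\<close>.\<close>

lemma fst_term_val:
  assumes "wf_term L_ogz t" "assignment U s"
  defines "k \<equiv> \<lambda>x. fst (s x)" and "g \<equiv> \<lambda>x. snd (s x)"
  shows "\<exists>p \<in> set (winding t). sat M g (snd p)"
    and "p \<in> set (winding t) \<Longrightarrow> sat M g (snd p) \<Longrightarrow> fst p k = fst (term_val U s t)"
proof -
  have "(\<exists>p \<in> set (winding t). sat M g (snd p)) \<and>
    (\<forall>p \<in> set (winding t). sat M g (snd p) \<longrightarrow> fst p k = fst (term_val U s t))"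
    using assms(1)
  proof (induction t)
    case (App f ts)
    show ?case
    proof (cases f)
      case OMult
      with App.prems obtain t u where ts: "ts = [t, u]"
        by (auto elim: length_2_cases)
      with App.prems OMult have wf: "wf_term L_ogz t" "wf_term L_ogz u" by auto
      define c where "c = uw_carry G R (term_val M g (cog_term t)) (term_val M g (cog_term u))"
      obtain a x where ax: "term_val U s t = (a, x)" by (cases "term_val U s t")
      obtain b y where bz: "term_val U s u = (b, y)" by (cases "term_val U s u")
      have cl: "x \<in> carrier G" "y \<in> carrier G"
        using snd_term_val_closed[OF wf(1) assms(2)] snd_term_val_closed[OF wf(2) assms(2)] ax bz
        by simp_all
      have c: "uw_carry G R x y = c"
        using snd_term_val[OF wf(1) assms(2)] snd_term_val[OF wf(2) assms(2)] ax bz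
        by (simp add: c_def g_def)
      have val: "fst (term_val U s (App f ts)) = a + b + c"
        using OMult ts ax bz cl c by (simp add: uw_mult_eq)
      have IH: "\<exists>p \<in> set (winding t). sat M g (snd p)" "\<exists>q \<in> set (winding u). sat M g (snd q)"
        "\<And>p. p \<in> set (winding t) \<Longrightarrow> sat M g (snd p) \<Longrightarrow> fst p k = a"
        "\<And>q. q \<in> set (winding u) \<Longrightarrow> sat M g (snd q) \<Longrightarrow> fst q k = b"
        using App.IH[of t] App.IH[of u] wf ts ax bz by simp_all
      note carry = sat_carry_cases[OF c_def]
      have eq: "set (winding (App f ts)) =
        (\<Union>p \<in> set (winding t). \<Union>q \<in> set (winding u).
          (\<lambda>r. (\<lambda>k. fst p k + fst q k + fst r, Conj (Conj (snd p) (snd q)) (snd r))) `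
            set (carry_cases (cog_term t) (cog_term u)))"
        by (simp add: OMult ts case_prod_unfold)
      show ?thesis
        unfolding val eq using IH(1,2) carry(1) by (auto simp: IH(3,4) carry(2))
    next
      case OInv
      with App.prems obtain t where ts: "ts = [t]"
        by (auto simp: length_Suc_conv)
      with App.prems OInv have wf: "wf_term L_ogz t" by auto
      obtain a x where ax: "term_val U s t = (a, x)" by (cases "term_val U s t")
      have cl: "x \<in> carrier G"
        using snd_term_val_closed[OF wf assms(2)] ax by simp
      have x: "term_val M g (cog_term t) = x"
        using snd_term_val[OF wf assms(2)] ax by (simp add: g_def)
      have val: "fst (term_val U s (App f ts)) = (if x = \<one> then - a else - a - 1)"
        using OInv ts ax cl by (simp add: uw_inv_eq)
      have IH: "\<exists>p \<in> set (winding t). sat M g (snd p)"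
        "\<And>p. p \<in> set (winding t) \<Longrightarrow> sat M g (snd p) \<Longrightarrow> fst p k = a"
        using App.IH[of t] wf ts ax by simp_all
      have eq: "set (winding (App f ts)) =
        (\<lambda>p. (\<lambda>k. - fst p k, Conj (snd p) (Equal (cog_term t) cOne))) ` set (winding t) \<union>
        (\<lambda>p. (\<lambda>k. - fst p k - 1, Conj (snd p) (Neg (Equal (cog_term t) cOne)))) ` set (winding t)"
        by (simp add: OInv ts case_prod_unfold)
      show ?thesis
        unfolding val eq using IH(1)
          by (cases "x = \<one>") (simp_all add: IH(2) x bex_Un ball_Un)
    qed auto
  qed (auto simp: k_def)
  then show "\<exists>p \<in> set (winding t). sat M g (snd p)"
    and "p \<in> set (winding t) \<Longrightarrow> sat M g (snd p) \<Longrightarrow> fst p k = fst (term_val U s t)"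
    by blast+
qed

end

section \<open>Disjunctions with separated integer and group conditions\<close>

type_synonym split = "(((nat \<Rightarrow> int) \<Rightarrow> bool) \<times> (cog_fun, cog_rel) fo_formula) list"

text \<open>De Morgan followed by distributivity: for each disjunct either its integer condition or
  its group formula fails, and one of these alternatives is chosen for every disjunct. The start
  value is the empty conjunction.\<close>

definition split_neg :: "split \<Rightarrow> split" where
  "split_neg D = foldr
     (\<lambda>(A, \<beta>) E. [(\<lambda>k. \<not> A k \<and> B k, \<gamma>). (B, \<gamma>) \<leftarrow> E] @ [(B, Conj (Neg \<beta>) \<gamma>). (B, \<gamma>) \<leftarrow> E])
     D [(\<lambda>_. True, cTrue)]"

text \<open>The order atom follows the lexicographic order: a smaller integer part, or equal integer
  parts and the order of the group parts. A quantified variable is a pair, so its integer half is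
  bound in the predicate and its group half in the formula.\<close>

primrec split_formula :: "(ogz_fun, ogz_rel) fo_formula \<Rightarrow> split" where
  "split_formula (Equal t u) =
     [(\<lambda>k. F k = F' k, Conj (Conj \<beta> \<beta>') (Equal (cog_term t) (cog_term u))).
        (F, \<beta>) \<leftarrow> winding t, (F', \<beta>') \<leftarrow> winding u]"
| "split_formula (Atom r ts) =
     (let t = ts ! 0; u = ts ! 1 in
     [(\<lambda>k. F k < F' k, Conj \<beta> \<beta>'). (F, \<beta>) \<leftarrow> winding t, (F', \<beta>') \<leftarrow> winding u] @
     [(\<lambda>k. F k = F' k, Conj (Conj \<beta> \<beta>')
         (Disj (Equal (cog_term t) (cog_term u))
           (Disj (Atom CCyc [cOne, cog_term t, cog_term u]) (Equal (cog_term t) cOne)))).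
        (F, \<beta>) \<leftarrow> winding t, (F', \<beta>') \<leftarrow> winding u])"
| "split_formula (Neg \<phi>) = split_neg (split_formula \<phi>)"
| "split_formula (Conj \<phi> \<psi>) =
     [(\<lambda>k. A k \<and> B k, Conj \<beta> \<gamma>). (A, \<beta>) \<leftarrow> split_formula \<phi>, (B, \<gamma>) \<leftarrow> split_formula \<psi>]"
| "split_formula (Exists x \<phi>) =
     [(\<lambda>k. \<exists>m. A (k(x := m)), Exists x \<beta>). (A, \<beta>) \<leftarrow> split_formula \<phi>]"

definition split_sat ::
  "(cog_fun, cog_rel, 'a) fo_structure \<Rightarrow> (nat \<Rightarrow> int) \<Rightarrow> (nat \<Rightarrow> 'a) \<Rightarrow> split \<Rightarrow> bool" where
  "split_sat M k g D \<longleftrightarrow> (\<exists>(A, \<beta>) \<in> set D. A k \<and> sat M g \<beta>)"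

lemma split_sat_cong:
  "(\<And>A \<beta>. (A, \<beta>) \<in> set D \<Longrightarrow> sat M g \<beta> \<longleftrightarrow> sat M' g' \<beta>) \<Longrightarrow>
    split_sat M k g D \<longleftrightarrow> split_sat M' k g' D"
  unfolding split_sat_def by (intro bex_cong) auto

lemma split_sat_neg: "split_sat M k g (split_neg D) \<longleftrightarrow> \<not> split_sat M k g D"
proof (induction D)
  case Nil
  then show ?case by (simp add: split_neg_def split_sat_def)
next
  case (Cons a D)
  obtain A \<beta> where a: "a = (A, \<beta>)" by (cases a)
  have "split_sat M k g (split_neg (a # D)) \<longleftrightarrow>
      (\<not> A k \<or> \<not> sat M g \<beta>) \<and> split_sat M k g (split_neg D)"
    by (simp add: split_neg_def split_sat_def a bex_Un case_prod_unfold) blast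
  moreover have "split_sat M k g (a # D) \<longleftrightarrow> A k \<and> sat M g \<beta> \<or> split_sat M k g D"
    by (simp add: split_sat_def a)
  ultimately show ?case
    using Cons by blast
qed

lemma split_neg_wf:
  assumes "\<And>A \<beta>. (A, \<beta>) \<in> set D \<Longrightarrow> wf_formula L_c \<beta> \<and> free_vars \<beta> \<subseteq> V"
  shows "(B, \<gamma>) \<in> set (split_neg D) \<Longrightarrow> wf_formula L_c \<gamma> \<and> free_vars \<gamma> \<subseteq> V"
  using assms
proof (induction D arbitrary: B \<gamma>)
  case Nil
  then show ?case by (simp add: split_neg_def)
next
  case (Cons a D)
  obtain A \<beta> where a: "a = (A, \<beta>)" by (cases a)
  with Cons.prems(1) obtain C \<delta> where
    "(C, \<delta>) \<in> set (split_neg D)" "\<gamma> = \<delta> \<or> \<gamma> = Conj (Neg \<beta>) \<delta>"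
    by (auto simp: split_neg_def)
  moreover have "wf_formula L_c \<delta> \<and> free_vars \<delta> \<subseteq> V"
    using calculation(1) Cons.IH[of C \<delta>] Cons.prems(2) by (meson list.set_intros(2))
  moreover have "wf_formula L_c \<beta> \<and> free_vars \<beta> \<subseteq> V"
    using Cons.prems(2) a by auto
  ultimately show ?case by auto
qed

text \<open>The bound on free variables turns every group formula in the split of a sentence into a
  sentence, so elementary equivalence applies to it.\<close>

lemma split_formula_wf:
  "wf_formula L_ogz \<phi> \<Longrightarrow> (A, \<beta>) \<in> set (split_formula \<phi>) \<Longrightarrow>
    wf_formula L_c \<beta> \<and> free_vars \<beta> \<subseteq> free_vars \<phi>"
proof (induction \<phi> arbitrary: A \<beta>)
  case (Equal t u)
  then show ?case
    using cog_term_vars[of t] cog_term_vars[of u]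
    by (fastforce dest: winding_wf cog_term_wf)
next
  case (Atom r ts)
  then obtain t u where "ts = [t, u]"
    by (auto elim: length_2_cases)
  with Atom show ?case
    using cog_term_vars[of t] cog_term_vars[of u]
    by (fastforce dest: winding_wf cog_term_wf)
next
  case (Neg \<phi>)
  then show ?case
    using split_neg_wf[of "split_formula \<phi>" "free_vars \<phi>" A \<beta>] by auto
next
  case (Conj \<phi> \<psi>)
  then obtain A1 \<beta>1 A2 \<beta>2 where
    "(A1, \<beta>1) \<in> set (split_formula \<phi>)" "(A2, \<beta>2) \<in> set (split_formula \<psi>)" "\<beta> = Conj \<beta>1 \<beta>2"
    by auto
  with Conj.IH[of A1 \<beta>1] Conj.IH(2)[of A2 \<beta>2] Conj.prems(1) show ?case by auto
next
  case (Exists x \<phi>)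
  then obtain B \<gamma> where "(B, \<gamma>) \<in> set (split_formula \<phi>)" "\<beta> = Exists x \<gamma>"
    by auto
  with Exists.IH[of B \<gamma>] Exists.prems(1) show ?case by auto
qed

context unwound_cog
begin

lemma bex_Times: "(\<exists>a \<in> UNIV \<times> C. P a) \<longleftrightarrow> (\<exists>m. \<exists>g \<in> C. P (m, g))"
  by auto

text \<open>The existential case works because quantification over pairs is a double quantification
  that distributes over the disjunction; within a disjunct the two quantifiers then separate, as the
  predicate sees only integer parts and the formula only group parts.\<close>

lemma sat_split_formula:
  "wf_formula L_ogz \<phi> \<Longrightarrow> assignment U s \<Longrightarrow>
    sat U s \<phi> \<longleftrightarrow> split_sat M (\<lambda>x. fst (s x)) (\<lambda>x. snd (s x)) (split_formula \<phi>)"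
proof (induction \<phi> arbitrary: s)
  case (Equal t u)
  let ?k = "\<lambda>x. fst (s x)" and ?g = "\<lambda>x. snd (s x)"
  from Equal.prems have wf: "wf_term L_ogz t" "wf_term L_ogz u" by auto
  note t = fst_term_val[OF wf(1) Equal.prems(2)] and u = fst_term_val[OF wf(2) Equal.prems(2)]
  have "split_sat M ?k ?g (split_formula (Equal t u)) \<longleftrightarrow>
      (\<exists>p \<in> set (winding t). \<exists>q \<in> set (winding u). fst p ?k = fst q ?k \<and>
        (sat M ?g (snd p) \<and> sat M ?g (snd q)) \<and>
        term_val M ?g (cog_term t) = term_val M ?g (cog_term u))"
    by (simp add: split_sat_def case_prod_unfold)
  also have "\<dots> \<longleftrightarrow> fst (term_val U s t) = fst (term_val U s u) \<and>
      term_val M ?g (cog_term t) = term_val M ?g (cog_term u)"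
    \<comment> \<open>Correctness of \<open>winding\<close> replaces the functions by the actual
      integer parts; coverage supplies cases \<open>p\<close> and \<open>q\<close> for the
      converse.\<close>
    using t u by metis
  also have "\<dots> \<longleftrightarrow> sat U s (Equal t u)"
    using snd_term_val[OF wf(1) Equal.prems(2)] snd_term_val[OF wf(2) Equal.prems(2)]
    by (simp add: prod_eq_iff)
  finally show ?case by simp
next
  case (Atom r ts)
  let ?k = "\<lambda>x. fst (s x)" and ?g = "\<lambda>x. snd (s x)"
  from Atom.prems obtain t u where ts: "ts = [t, u]"
    by (auto elim: length_2_cases)
  with Atom.prems have wf: "wf_term L_ogz t" "wf_term L_ogz u" by auto
  note t = fst_term_val[OF wf(1) Atom.prems(2)] and u = fst_term_val[OF wf(2) Atom.prems(2)]
  let ?t = "term_val M ?g (cog_term t)" and ?u = "term_val M ?g (cog_term u)"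
  have "split_sat M ?k ?g (split_formula (Atom r ts)) \<longleftrightarrow>
      (\<exists>p \<in> set (winding t). \<exists>q \<in> set (winding u). fst p ?k < fst q ?k \<and>
        sat M ?g (snd p) \<and> sat M ?g (snd q)) \<or>
      (\<exists>p \<in> set (winding t). \<exists>q \<in> set (winding u). fst p ?k = fst q ?k \<and>
        (sat M ?g (snd p) \<and> sat M ?g (snd q)) \<and> (?t = ?u \<or> R \<one> ?t ?u \<or> ?t = \<one>))"
    by (simp add: split_sat_def case_prod_unfold ts Let_def bex_Un)
  also have "(\<exists>p \<in> set (winding t). \<exists>q \<in> set (winding u). fst p ?k < fst q ?k \<and>
        sat M ?g (snd p) \<and> sat M ?g (snd q)) \<longleftrightarrow> fst (term_val U s t) < fst (term_val U s u)"
    using t u by metis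
  also have "(\<exists>p \<in> set (winding t). \<exists>q \<in> set (winding u). fst p ?k = fst q ?k \<and>
        (sat M ?g (snd p) \<and> sat M ?g (snd q)) \<and> (?t = ?u \<or> R \<one> ?t ?u \<or> ?t = \<one>)) \<longleftrightarrow>
      fst (term_val U s t) = fst (term_val U s u) \<and> (?t = ?u \<or> R \<one> ?t ?u \<or> ?t = \<one>)"
    using t u by metis
  also have "fst (term_val U s t) < fst (term_val U s u) \<or>
      fst (term_val U s t) = fst (term_val U s u) \<and> (?t = ?u \<or> R \<one> ?t ?u \<or> ?t = \<one>) \<longleftrightarrow>
      sat U s (Atom r ts)"
    using snd_term_val[OF wf(1) Atom.prems(2)] snd_term_val[OF wf(2) Atom.prems(2)]
    by (cases "term_val U s t"; cases "term_val U s u") (auto simp: ts uw_le_def)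
  finally show ?case by simp
next
  case (Neg \<phi>)
  then show ?case by (simp add: split_sat_neg)
next
  case (Conj \<phi> \<psi>)
  then show ?case
    by (simp add: split_sat_def case_prod_unfold) blast
next
  case (Exists x \<phi>)
  have fst: "(\<lambda>y. fst ((s(x := (m, g))) y)) = (\<lambda>y. fst (s y))(x := m)"
    and snd: "(\<lambda>y. snd ((s(x := (m, g))) y)) = (\<lambda>y. snd (s y))(x := g)" for m :: int and g :: 'a
    by auto
  have sat_upd: "sat U (s(x := (m, g))) \<phi> \<longleftrightarrow>
      split_sat M ((\<lambda>x. fst (s x))(x := m)) ((\<lambda>x. snd (s x))(x := g)) (split_formula \<phi>)"
    if "g \<in> carrier G" for m g
  proof -
    have wf: "wf_formula L_ogz \<phi>"
      using Exists.prems by simp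
    have upd: "assignment U (s(x := (m, g)))"
      using Exists.prems that by (simp add: assignment_uw)
    show ?thesis
      by (rule Exists.IH[OF wf upd, unfolded fst snd])
  qed
  have "sat U s (Exists x \<phi>) \<longleftrightarrow> (\<exists>m. \<exists>g\<in>carrier G.
      split_sat M ((\<lambda>x. fst (s x))(x := m)) ((\<lambda>x. snd (s x))(x := g)) (split_formula \<phi>))"
    by (simp only: sat.simps uw_structure_simps bex_Times sat_upd cong: bex_cong)
  also have "\<dots> \<longleftrightarrow> split_sat M (\<lambda>x. fst (s x)) (\<lambda>x. snd (s x)) (split_formula (Exists x \<phi>))"
    by (simp add: split_sat_def case_prod_unfold) blast
  finally show ?case .
qed

end


section \<open>Interpreting the group in its unwound\<close>

abbreviation oOne :: "ogz_fun fo_term" where "oOne \<equiv> App OOne []"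
abbreviation oZ :: "ogz_fun fo_term" where "oZ \<equiv> App OConst []"
abbreviation oInv :: "ogz_fun fo_term \<Rightarrow> ogz_fun fo_term" where "oInv t \<equiv> App OInv [t]"
abbreviation oMult :: "ogz_fun fo_term \<Rightarrow> ogz_fun fo_term \<Rightarrow> ogz_fun fo_term" where
  "oMult t u \<equiv> App OMult [t, u]"

text \<open>On elements \<open>(0, g)\<close> all candidates have the group part of the given term, and one of them
  has integer part \<open>0\<close>.\<close>

primrec candidates :: "cog_fun fo_term \<Rightarrow> ogz_fun fo_term list" where
  "candidates (Var x) = [Var x]"
| "candidates (App f ts) =
    (let ws = map candidates ts in case f of
      CMult \<Rightarrow> [oMult t u. t \<leftarrow> ws ! 0, u \<leftarrow> ws ! 1] @
               [oMult (oMult t u) (oInv oZ). t \<leftarrow> ws ! 0, u \<leftarrow> ws ! 1]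
    | COne \<Rightarrow> [oOne]
    | CInv \<Rightarrow> [oInv t. t \<leftarrow> ws ! 0] @ [oMult (oInv t) oZ. t \<leftarrow> ws ! 0])"

text \<open>The interval from the identity up to but excluding \<open>z\<close>, which serves as the
  copy of \<open>G\<close> in its unwound.\<close>

definition oUnit :: "ogz_fun fo_term \<Rightarrow> (ogz_fun, ogz_rel) fo_formula" where
  "oUnit t = Conj (Atom OLe [oOne, t]) (Neg (Atom OLe [oZ, t]))"

definition oLess :: "ogz_fun fo_term \<Rightarrow> ogz_fun fo_term \<Rightarrow> (ogz_fun, ogz_rel) fo_formula" where
  "oLess t u = Conj (Atom OLe [t, u]) (Neg (Equal t u))"

text \<open>The right-hand side of \<open>R_iff_less_cut\<close> in the language of the
  unwound.\<close>

definition oCyc ::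
  "ogz_fun fo_term \<Rightarrow> ogz_fun fo_term \<Rightarrow> ogz_fun fo_term \<Rightarrow> (ogz_fun, ogz_rel) fo_formula" where
  "oCyc t u v = Disj (Conj (oLess t u) (oLess u v))
     (Disj (Conj (oLess u v) (oLess v t)) (Conj (oLess v t) (oLess t u)))"

text \<open>Ends the finite disjunctions over candidates.\<close>

abbreviation oFalse :: "(ogz_fun, ogz_rel) fo_formula" where "oFalse \<equiv> Neg (Equal oOne oOne)"

text \<open>Atomic formulas guess a candidate with integer part 0 for each term; several candidates
  may qualify, but they then have the same value. Quantifiers are relativised to
  \<open>oUnit\<close>.\<close>

primrec ogz_formula :: "(cog_fun, cog_rel) fo_formula \<Rightarrow> (ogz_fun, ogz_rel) fo_formula" where
  "ogz_formula (Equal t u) = foldr Disj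
     [Conj (Conj (oUnit t') (oUnit u')) (Equal t' u'). t' \<leftarrow> candidates t, u' \<leftarrow> candidates u] oFalse"
| "ogz_formula (Atom r ts) = foldr Disj
     [Conj (Conj (oUnit t') (Conj (oUnit u') (oUnit v'))) (oCyc t' u' v').
       t' \<leftarrow> candidates (ts ! 0), u' \<leftarrow> candidates (ts ! 1), v' \<leftarrow> candidates (ts ! 2)] oFalse"
| "ogz_formula (Neg \<phi>) = Neg (ogz_formula \<phi>)"
| "ogz_formula (Conj \<phi> \<psi>) = Conj (ogz_formula \<phi>) (ogz_formula \<psi>)"
| "ogz_formula (Exists x \<phi>) = Exists x (Conj (oUnit (Var x)) (ogz_formula \<phi>))"

lemma candidates_wf:
  "wf_term L_c t \<Longrightarrow> t' \<in> set (candidates t) \<Longrightarrow> wf_term L_ogz t' \<and> term_vars t' \<subseteq> term_vars t"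
proof (induction t arbitrary: t')
  case (App f ts)
  show ?case
  proof (cases f)
    case CMult
    with App.prems obtain t u where ts: "ts = [t, u]"
      by (auto elim: length_2_cases)
    from App.prems CMult ts obtain v w where
      vw: "v \<in> set (candidates t)" "w \<in> set (candidates u)"
        "t' = oMult v w \<or> t' = oMult (oMult v w) (oInv oZ)"
      by auto
    with App.IH[of t v] App.IH[of u w] App.prems CMult ts show ?thesis by auto
  next
    case CInv
    with App.prems obtain t where ts: "ts = [t]"
      by (auto simp: length_Suc_conv)
    from App.prems CInv ts obtain v where
      v: "v \<in> set (candidates t)" "t' = oInv v \<or> t' = oMult (oInv v) oZ"
      by auto
    with App.IH[of t v] App.prems CInv ts show ?thesis by auto
  qed (use App.prems in auto)
qed simp

lemma ogz_formula_wf: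
  "wf_formula L_c \<phi> \<Longrightarrow> wf_formula L_ogz (ogz_formula \<phi>) \<and> free_vars (ogz_formula \<phi>) \<subseteq> free_vars \<phi>"
proof (induction \<phi>)
  case (Equal t u)
  then show ?case
    by (auto simp: wf_foldr_Disj free_vars_foldr_Disj oUnit_def dest: candidates_wf)
next
  case (Atom r ts)
  then obtain t u v where "ts = [t, u, v]"
    by (auto elim: length_3_cases)
  with Atom show ?case
    by (auto simp: wf_foldr_Disj free_vars_foldr_Disj oUnit_def oLess_def oCyc_def
        dest: candidates_wf)
qed (auto simp: oUnit_def)

section \<open>The group as the level of integer part zero\<close>

context unwound_cog
begin

text \<open>The pair \<open>(m, \<one>)\<close> is least among the pairs with integer part
  \<open>m\<close>, so the two comparisons say that the integer part is at least 0 and not at least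
  1.\<close>

lemma sat_oUnit: "sat U s (oUnit t) \<longleftrightarrow> fst (term_val U s t) = 0"
  by (cases "term_val U s t") (auto simp: oUnit_def uw_le_def)

lemma sat_oLess:
  assumes "term_val U s t = (0, x)" "term_val U s u = (0, y)"
  shows "sat U s (oLess t u) \<longleftrightarrow> less_cut x y"
  using assms by (auto simp: oLess_def uw_le_def less_cut_def)

lemma sat_oCyc:
  assumes "term_val U s t = (0, x)" "term_val U s u = (0, y)" "term_val U s v = (0, w)"
    and "x \<in> carrier G" "y \<in> carrier G" "w \<in> carrier G"
  shows "sat U s (oCyc t u v) \<longleftrightarrow> R x y w"
  unfolding R_iff_less_cut[OF assms(4-6)]
  by (simp add: oCyc_def sat_oLess[OF assms(1,2)] sat_oLess[OF assms(2,3)] sat_oLess[OF assms(3,1)])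

text \<open>On pairs with integer part 0, a product has integer part 0 or 1 and an inverse 0 or -1.
  The additional candidates correct this by one factor \<open>z\<close> or its inverse, which leaves
  the group part unchanged.\<close>

lemma candidates_val:
  assumes "wf_term L_c t" "assignment M s"
  shows "(0, term_val M s t) \<in> term_val U (\<lambda>x. (0, s x)) ` set (candidates t) \<and>
    (\<forall>t' \<in> set (candidates t). snd (term_val U (\<lambda>x. (0, s x)) t') = term_val M s t)"
  using assms
proof (induction t)
  case (App f ts)
  let ?s = "\<lambda>x. (0, s x)"
  \<comment> \<open>Multiplying by a power of \<open>z\<close> causes no carry and so shifts only
    the integer part.\<close>
  have carry_one: "uw_carry G R g \<one> = 0" for g
    by (simp add: uw_carry_def)
  show ?case
  proof (cases f)
    case CMult
    with App.prems obtain t u where ts: "ts = [t, u]"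
      by (auto elim: length_2_cases)
    with App.prems CMult have wf: "wf_term L_c t" "wf_term L_c u" by auto
    define g h where "g = term_val M s t" and "h = term_val M s u"
    have cl: "g \<in> carrier G" "h \<in> carrier G"
      using wf App.prems cog_term_val_closed by (auto simp: g_def h_def)
    from App.IH[of t] App.IH[of u] ts wf App.prems have IH:
      "(0, g) \<in> term_val U ?s ` set (candidates t)" "(0, h) \<in> term_val U ?s ` set (candidates u)"
      "\<And>t'. t' \<in> set (candidates t) \<Longrightarrow> snd (term_val U ?s t') = g"
      "\<And>t'. t' \<in> set (candidates u) \<Longrightarrow> snd (term_val U ?s t') = h"
      by (auto simp: g_def h_def)
    have carry: "uw_carry G R g h = 0 \<or> uw_carry G R g h = 1"
      by (simp add: uw_carry_def)
    have val: "term_val M s (App f ts) = g \<otimes> h"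
      by (simp add: CMult ts g_def h_def)
    have mult: "snd (term_val U ?s (oMult v w)) = g \<otimes> h"
      "snd (term_val U ?s (oMult (oMult v w) (oInv oZ))) = g \<otimes> h"
      if "v \<in> set (candidates t)" "w \<in> set (candidates u)" for v w
      using IH(3)[OF that(1)] IH(4)[OF that(2)] cl
      by (cases "term_val U ?s v"; cases "term_val U ?s w"; simp add: uw_mult_eq uw_inv_eq)+
    show ?thesis
    proof
      from IH(1) obtain v where v: "v \<in> set (candidates t)" "term_val U ?s v = (0, g)" by force
      from IH(2) obtain w where w: "w \<in> set (candidates u)" "term_val U ?s w = (0, h)" by force
      from v w have "{oMult v w, oMult (oMult v w) (oInv oZ)} \<subseteq> set (candidates (App f ts))"
        using CMult ts by auto
      \<comment> \<open>The first candidate serves when the carry is 0, the second when it is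
        1.\<close>
      moreover have "(0, g \<otimes> h) \<in> term_val U ?s ` {oMult v w, oMult (oMult v w) (oInv oZ)}"
        using v w cl carry by (auto simp: uw_mult_eq uw_inv_eq carry_one)
      ultimately show "(0, term_val M s (App f ts)) \<in> term_val U ?s ` set (candidates (App f ts))"
        unfolding val by blast
      show "\<forall>t' \<in> set (candidates (App f ts)). snd (term_val U ?s t') = term_val M s (App f ts)"
        unfolding val using mult CMult ts by (auto simp del: term_val.simps)
    qed
  next
    case CInv
    with App.prems obtain t where ts: "ts = [t]"
      by (auto simp: length_Suc_conv)
    with App.prems CInv have wf: "wf_term L_c t" by auto
    define g where "g = term_val M s t"
    have cl: "g \<in> carrier G"
      using wf App.prems cog_term_val_closed by (auto simp: g_def)
    from App.IH[of t] ts wf App.prems have IH: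
      "(0, g) \<in> term_val U ?s ` set (candidates t)"
      "\<And>t'. t' \<in> set (candidates t) \<Longrightarrow> snd (term_val U ?s t') = g"
      by (auto simp: g_def)
    have val: "term_val M s (App f ts) = inv g"
      by (simp add: CInv ts g_def)
    have inv: "snd (term_val U ?s (oInv v)) = inv g" "snd (term_val U ?s (oMult (oInv v) oZ)) = inv g"
      if "v \<in> set (candidates t)" for v
      using IH(2)[OF that] cl
      by (cases "term_val U ?s v"; simp add: uw_mult_eq uw_inv_eq)+
    show ?thesis
    proof
      from IH(1) obtain v where v: "v \<in> set (candidates t)" "term_val U ?s v = (0, g)" by force
      then have "{oInv v, oMult (oInv v) oZ} \<subseteq> set (candidates (App f ts))"
        using CInv ts by auto
      \<comment> \<open>The first candidate serves when \<open>g\<close> is the identity, the second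
        otherwise.\<close>
      moreover have "(0, inv g) \<in> term_val U ?s ` {oInv v, oMult (oInv v) oZ}"
        using v cl by (auto simp: uw_mult_eq uw_inv_eq carry_one)
      ultimately show "(0, term_val M s (App f ts)) \<in> term_val U ?s ` set (candidates (App f ts))"
        unfolding val by blast
      show "\<forall>t' \<in> set (candidates (App f ts)). snd (term_val U ?s t') = term_val M s (App f ts)"
        unfolding val using inv CInv ts by (auto simp del: term_val.simps)
    qed
  qed simp
qed simp

lemma sat_ogz_formula:
  "wf_formula L_c \<phi> \<Longrightarrow> assignment M s \<Longrightarrow>
    sat U (\<lambda>x. (0, s x)) (ogz_formula \<phi>) \<longleftrightarrow> sat M s \<phi>"
proof (induction \<phi> arbitrary: s)
  case (Equal t u)
  let ?s = "\<lambda>x. (0, s x)"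
  let ?P = "\<lambda>t a. \<exists>t' \<in> set (candidates t). term_val U ?s t' = (0, a)"
  \<comment> \<open>The candidates with integer part 0 determine the value of \<open>t\<close>: one
    of them attains it, and all have its group part.\<close>
  have unit: "?P t a \<longleftrightarrow> a = term_val M s t" if "wf_term L_c t" for t a
    using candidates_val[OF that Equal.prems(2)] by force
  have "sat U ?s (ogz_formula (Equal t u)) \<longleftrightarrow> (\<exists>a. ?P t a \<and> ?P u a)"
    by (fastforce simp: sat_foldr_Disj sat_oUnit prod_eq_iff)
  with unit Equal.prems show ?case by auto
next
  case (Atom r ts)
  let ?s = "\<lambda>x. (0, s x)"
  let ?P = "\<lambda>t a. \<exists>t' \<in> set (candidates t). term_val U ?s t' = (0, a)"
  have unit: "?P t a \<longleftrightarrow> a = term_val M s t" if "wf_term L_c t" for t a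
    using candidates_val[OF that Atom.prems(2)] by force
  from Atom.prems obtain t u v where ts: "ts = [t, u, v]"
    by (auto elim: length_3_cases)
  with Atom.prems have wf: "wf_term L_c t" "wf_term L_c u" "wf_term L_c v" by auto
  note cl = wf[THEN cog_term_val_closed, OF Atom.prems(2)]
  have val: "term_val U ?s t' = (0, term_val M s t)"
    if "t' \<in> set (candidates t)" "fst (term_val U ?s t') = 0" "wf_term L_c t" for t t'
    using candidates_val[OF that(3) Atom.prems(2)] that by (simp add: prod_eq_iff)
  have "sat U ?s (ogz_formula (Atom r ts)) \<longleftrightarrow>
      (\<exists>t' \<in> set (candidates t). \<exists>u' \<in> set (candidates u). \<exists>v' \<in> set (candidates v).
        fst (term_val U ?s t') = 0 \<and> fst (term_val U ?s u') = 0 \<and> fst (term_val U ?s v') = 0 \<and>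
        sat U ?s (oCyc t' u' v'))"
    by (auto simp: sat_foldr_Disj sat_oUnit ts)
  also have "\<dots> \<longleftrightarrow> R (term_val M s t) (term_val M s u) (term_val M s v)"
  proof
    assume "R (term_val M s t) (term_val M s u) (term_val M s v)"
    moreover have "?P t (term_val M s t)" "?P u (term_val M s u)" "?P v (term_val M s v)"
      using unit wf by simp_all
    then obtain t' u' v' where
      *: "t' \<in> set (candidates t)" "u' \<in> set (candidates u)" "v' \<in> set (candidates v)"
      and vals: "term_val U ?s t' = (0, term_val M s t)" "term_val U ?s u' = (0, term_val M s u)"
        "term_val U ?s v' = (0, term_val M s v)"
      by blast
    ultimately have "sat U ?s (oCyc t' u' v')"
      using sat_oCyc[OF vals cl] by blast
    with * vals show "\<exists>t' \<in> set (candidates t). \<exists>u' \<in> set (candidates u). \<exists>v' \<in> set (candidates v).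
        fst (term_val U ?s t') = 0 \<and> fst (term_val U ?s u') = 0 \<and> fst (term_val U ?s v') = 0 \<and>
        sat U ?s (oCyc t' u' v')"
      by (intro bexI[of _ t'] bexI[of _ u'] bexI[of _ v']) simp_all
  next
    assume "\<exists>t' \<in> set (candidates t). \<exists>u' \<in> set (candidates u). \<exists>v' \<in> set (candidates v).
        fst (term_val U ?s t') = 0 \<and> fst (term_val U ?s u') = 0 \<and> fst (term_val U ?s v') = 0 \<and>
        sat U ?s (oCyc t' u' v')"
    then obtain t' u' v' where
      *: "t' \<in> set (candidates t)" "u' \<in> set (candidates u)" "v' \<in> set (candidates v)"
        "fst (term_val U ?s t') = 0" "fst (term_val U ?s u') = 0" "fst (term_val U ?s v') = 0"
      and cyc: "sat U ?s (oCyc t' u' v')"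
      by blast
    from val[OF *(1,4) wf(1)] val[OF *(2,5) wf(2)] val[OF *(3,6) wf(3)]
    have "sat U ?s (oCyc t' u' v') \<longleftrightarrow> R (term_val M s t) (term_val M s u) (term_val M s v)"
      by (rule sat_oCyc) (fact cl)+
    with cyc show "R (term_val M s t) (term_val M s u) (term_val M s v)"
      by blast
  qed
  finally show ?case by (simp add: ts)
next
  case (Exists x \<phi>)
  have upd: "(\<lambda>y. (0, s y))(x := (0, g)) = (\<lambda>y. (0, (s(x := g)) y))" for g
    by auto
  have "sat U (\<lambda>y. (0, (s(x := g)) y)) (ogz_formula \<phi>) \<longleftrightarrow> sat M (s(x := g)) \<phi>"
    if "g \<in> carrier G" for g
    using that Exists.prems by (intro Exists.IH) (auto simp: assignment_cog)
  then have "(\<exists>g \<in> carrier G. sat U ((\<lambda>y. (0, s y))(x := (0, g))) (ogz_formula \<phi>)) \<longleftrightarrow>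
      sat M s (Exists x \<phi>)"
    unfolding upd by auto
  then show ?case
    by (auto simp: sat_oUnit)
qed auto

end


section \<open>Transfer of elementary equivalence and elementary inclusion\<close>

text \<open>The split of a sentence does not depend on the group. Its group formulas are sentences
  of \<open>L_c\<close>, on which the two groups agree.\<close>

lemma uw_elem_equiv:
  assumes "cyclically_ordered_group G R" "cyclically_ordered_group G' R'"
    and equiv: "elem_equiv L_c (cog_structure G R) (cog_structure G' R')"
  shows "elem_equiv L_ogz (uw_structure G R) (uw_structure G' R')"
  unfolding elem_equiv_def
proof (intro allI impI)
  interpret G: unwound_cog G R using assms by (simp add: unwound_cog_def)
  interpret G': unwound_cog G' R' using assms by (simp add: unwound_cog_def)
  fix \<phi> :: "(ogz_fun, ogz_rel) fo_formula"
  assume \<phi>: "sentence L_ogz \<phi>"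
  \<comment> \<open>Any assignment decides a sentence; these two have the same integer parts, so the
    integer conditions of the split are evaluated at the same point for both groups.\<close>
  define s where "s = (\<lambda>_::nat. (0::int, \<one>\<^bsub>G\<^esub>))"
  define s' where "s' = (\<lambda>_::nat. (0::int, \<one>\<^bsub>G'\<^esub>))"
  have s: "assignment G.U s" "assignment G'.U s'"
    by (simp_all add: s_def s'_def assignment_uw)
  have "sat G.M (\<lambda>x. snd (s x)) \<beta> \<longleftrightarrow> sat G'.M (\<lambda>x. snd (s' x)) \<beta>"
    if "(A, \<beta>) \<in> set (split_formula \<phi>)" for A \<beta>
  proof -
    have "sentence L_c \<beta>"
      using \<phi> split_formula_wf[OF _ that] by (auto simp: sentence_def)
    with equiv s show ?thesis
      using models_sentence_iff G.snd_assignment G'.snd_assignment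
      unfolding elem_equiv_def by metis
  qed
  then have "split_sat G.M (\<lambda>x. fst (s x)) (\<lambda>x. snd (s x)) (split_formula \<phi>) \<longleftrightarrow>
      split_sat G'.M (\<lambda>x. fst (s x)) (\<lambda>x. snd (s' x)) (split_formula \<phi>)"
    by (rule split_sat_cong)
  moreover have "(\<lambda>x. fst (s x)) = (\<lambda>x. fst (s' x))"
    by (simp add: s_def s'_def)
  ultimately have "sat G.U s \<phi> \<longleftrightarrow> sat G'.U s' \<phi>"
    using \<phi> s G.sat_split_formula G'.sat_split_formula by (auto simp: sentence_def)
  then show "models G.U \<phi> \<longleftrightarrow> models G'.U \<phi>"
    using models_sentence_iff \<phi> s by metis
qed

lemma cog_elem_equiv:
  assumes "cyclically_ordered_group G R" "cyclically_ordered_group G' R'"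
    and equiv: "elem_equiv L_ogz (uw_structure G R) (uw_structure G' R')"
  shows "elem_equiv L_c (cog_structure G R) (cog_structure G' R')"
  unfolding elem_equiv_def
proof (intro allI impI)
  interpret G: unwound_cog G R using assms by (simp add: unwound_cog_def)
  interpret G': unwound_cog G' R' using assms by (simp add: unwound_cog_def)
  fix \<phi> :: "(cog_fun, cog_rel) fo_formula"
  assume \<phi>: "sentence L_c \<phi>"
  then have \<psi>: "sentence L_ogz (ogz_formula \<phi>)"
    using ogz_formula_wf by (auto simp: sentence_def)
  define s where "s = (\<lambda>_::nat. \<one>\<^bsub>G\<^esub>)"
  define s' where "s' = (\<lambda>_::nat. \<one>\<^bsub>G'\<^esub>)"
  have s: "assignment G.M s" "assignment G'.M s'"
    by (simp_all add: s_def s'_def assignment_cog)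
  then have "assignment G.U (\<lambda>x. (0, s x))" "assignment G'.U (\<lambda>x. (0, s' x))"
    by (simp_all add: assignment_cog assignment_uw)
  with equiv \<psi> have "sat G.U (\<lambda>x. (0, s x)) (ogz_formula \<phi>) \<longleftrightarrow>
      sat G'.U (\<lambda>x. (0, s' x)) (ogz_formula \<phi>)"
    using models_sentence_iff unfolding elem_equiv_def by metis
  with \<phi> s have "sat G.M s \<phi> \<longleftrightarrow> sat G'.M s' \<phi>"
    using G.sat_ogz_formula G'.sat_ogz_formula by (auto simp: sentence_def)
  then show "models G.M \<phi> \<longleftrightarrow> models G'.M \<phi>"
    using models_sentence_iff \<phi> s by metis
qed

section \<open>Substructures and elementary inclusion\<close>

lemma substructure_cog_iff:
  "substructure L_c (cog_structure H S) (cog_structure H' S') \<longleftrightarrow>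
    carrier H \<subseteq> carrier H' \<and>
    (\<forall>x\<in>carrier H. \<forall>y\<in>carrier H. x \<otimes>\<^bsub>H\<^esub> y = x \<otimes>\<^bsub>H'\<^esub> y) \<and>
    \<one>\<^bsub>H\<^esub> = \<one>\<^bsub>H'\<^esub> \<and> (\<forall>x\<in>carrier H. inv\<^bsub>H\<^esub> x = inv\<^bsub>H'\<^esub> x) \<and>
    (\<forall>x\<in>carrier H. \<forall>y\<in>carrier H. \<forall>z\<in>carrier H. S x y z \<longleftrightarrow> S' x y z)"
  (is "?sub \<longleftrightarrow> ?rhs")
proof
  assume sub: ?sub
  then have f: "set xs \<subseteq> carrier H \<Longrightarrow> length xs = fun_arity L_c f \<Longrightarrow>
      fun_interp (cog_structure H S) f xs = fun_interp (cog_structure H' S') f xs"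
    and r: "set xs \<subseteq> carrier H \<Longrightarrow> length xs = rel_arity L_c r \<Longrightarrow>
      rel_interp (cog_structure H S) r xs \<longleftrightarrow> rel_interp (cog_structure H' S') r xs" for f r xs
    by (auto simp: substructure_def)
  have "x \<otimes>\<^bsub>H\<^esub> y = x \<otimes>\<^bsub>H'\<^esub> y" if "x \<in> carrier H" "y \<in> carrier H" for x y
    using f[of "[x, y]" CMult] that by simp
  moreover have "\<one>\<^bsub>H\<^esub> = \<one>\<^bsub>H'\<^esub>"
    using f[of "[]" COne] by simp
  moreover have "inv\<^bsub>H\<^esub> x = inv\<^bsub>H'\<^esub> x" if "x \<in> carrier H" for x
    using f[of "[x]" CInv] that by simp
  moreover have "S x y z \<longleftrightarrow> S' x y z" if "x \<in> carrier H" "y \<in> carrier H" "z \<in> carrier H" for x y z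
    using r[of "[x, y, z]"] that by simp
  ultimately show ?rhs
    using sub by (simp add: substructure_def)
next
  assume rhs: ?rhs
  have "fun_interp (cog_structure H S) f xs = fun_interp (cog_structure H' S') f xs"
    if "set xs \<subseteq> carrier H" "length xs = fun_arity L_c f" for f xs
    by (cases f) (use that rhs in \<open>auto simp: length_Suc_conv elim!: length_2_cases\<close>)
  then show ?sub
    using rhs by (auto simp: substructure_def elim!: length_3_cases)
qed

lemma uw_substructure:
  assumes "cyclically_ordered_group H S" "cyclically_ordered_group H' S'"
    and sub: "substructure L_c (cog_structure H S) (cog_structure H' S')"
  shows "substructure L_ogz (uw_structure H S) (uw_structure H' S')"
proof -
  interpret H: unwound_cog H S using assms by (simp add: unwound_cog_def)
  interpret H': unwound_cog H' S' using assms by (simp add: unwound_cog_def)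
  note sub = sub[unfolded substructure_cog_iff]
  have mult: "uw_mult H S p q = uw_mult H' S' p q"
    if "snd p \<in> carrier H" "snd q \<in> carrier H" for p q
  proof -
    obtain k g m h where pq: "p = (k, g)" "q = (m, h)"
      by (cases p, cases q)
    with that have gh: "g \<in> carrier H" "h \<in> carrier H" "g \<in> carrier H'" "h \<in> carrier H'"
      "g \<otimes>\<^bsub>H\<^esub> h = g \<otimes>\<^bsub>H'\<^esub> h"
      using sub by auto
    then have "S \<one>\<^bsub>H\<^esub> g (g \<otimes>\<^bsub>H\<^esub> h) \<longleftrightarrow> S' \<one>\<^bsub>H\<^esub> g (g \<otimes>\<^bsub>H\<^esub> h)"
      using sub H.m_closed by blast
    with gh sub have "uw_carry H S g h = uw_carry H' S' g h"
      by (simp add: uw_carry_def)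
    with gh pq show ?thesis
      by (simp add: H.uw_mult_eq H'.uw_mult_eq)
  qed
  \<comment> \<open>The two inverses are definite descriptions over different carriers; the closed
    form \<open>uw_inv_eq\<close> makes them comparable.\<close>
  have inv: "inv\<^bsub>uw H S\<^esub> p = inv\<^bsub>uw H' S'\<^esub> p" if "snd p \<in> carrier H" for p
    using that sub by (cases p) (auto simp: H.uw_inv_eq H'.uw_inv_eq subset_iff)
  have le: "uw_le H S p q \<longleftrightarrow> uw_le H' S' p q"
    if "snd p \<in> carrier H" "snd q \<in> carrier H" for p q
    using that sub H.one_closed by (auto simp: uw_le_def split: prod.splits)
  have "fun_interp H.U f xs = fun_interp H'.U f xs"
    if "set xs \<subseteq> UNIV \<times> carrier H" "length xs = fun_arity L_ogz f" for f xs
    by (cases f)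
      (use that sub mult inv in \<open>auto simp: length_Suc_conv elim!: length_2_cases\<close>)
  moreover have "uw_le H S (xs ! 0) (xs ! 1) \<longleftrightarrow> uw_le H' S' (xs ! 0) (xs ! 1)"
    if "set xs \<subseteq> UNIV \<times> carrier H" "length xs = 2" for xs
    using that le by (auto elim!: length_2_cases)
  ultimately show ?thesis
    using sub by (auto simp: substructure_def)
qed

lemma uw_z_cong:
  "substructure L_c (cog_structure H S) (cog_structure H' S') \<Longrightarrow> uw_z H = uw_z H'"
  unfolding substructure_cog_iff uw_z_def by simp

text \<open>The same translations work with parameters: an assignment in the smaller structure is
  also one in the larger, with the same integer and group parts, so both structures evaluate the
  same split, respectively the same interpreted formula, at the same point.\<close>

lemma uw_elem_substructure_iff:
  assumes "cyclically_ordered_group H S" "cyclically_ordered_group H' S'"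
    and sub: "substructure L_c (cog_structure H S) (cog_structure H' S')"
  shows "elem_substructure L_c (cog_structure H S) (cog_structure H' S') \<longleftrightarrow>
    elem_substructure L_ogz (uw_structure H S) (uw_structure H' S')"
proof -
  interpret H: unwound_cog H S using assms by (simp add: unwound_cog_def)
  interpret H': unwound_cog H' S' using assms by (simp add: unwound_cog_def)
  have M: "assignment H'.M s" if "assignment H.M s" for s
    using that sub by (auto simp: substructure_def assignment_def)
  have U: "assignment H'.U s" if "assignment H.U s" for s
    using that sub by (auto simp: substructure_def assignment_uw)
  show ?thesis
  proof
    assume elem: "elem_substructure L_c H.M H'.M"
    have "sat H.U s \<phi> \<longleftrightarrow> sat H'.U s \<phi>" if "wf_formula L_ogz \<phi>" "assignment H.U s" for \<phi> s
    proof -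
      have "sat H.M (\<lambda>x. snd (s x)) \<beta> \<longleftrightarrow> sat H'.M (\<lambda>x. snd (s x)) \<beta>"
        if "(A, \<beta>) \<in> set (split_formula \<phi>)" for A \<beta>
        using elem split_formula_wf[OF \<open>wf_formula L_ogz \<phi>\<close> that]
          H.snd_assignment[OF \<open>assignment H.U s\<close>]
        by (auto simp: elem_substructure_def)
      then have "split_sat H.M (\<lambda>x. fst (s x)) (\<lambda>x. snd (s x)) (split_formula \<phi>) \<longleftrightarrow>
          split_sat H'.M (\<lambda>x. fst (s x)) (\<lambda>x. snd (s x)) (split_formula \<phi>)"
        by (rule split_sat_cong)
      with that U[OF that(2)] show ?thesis
        by (simp add: H.sat_split_formula H'.sat_split_formula)
    qed
    then show "elem_substructure L_ogz H.U H'.U"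
      using uw_substructure[OF assms] by (simp add: elem_substructure_def)
  next
    assume elem: "elem_substructure L_ogz H.U H'.U"
    have "sat H.M s \<phi> \<longleftrightarrow> sat H'.M s \<phi>" if "wf_formula L_c \<phi>" "assignment H.M s" for \<phi> s
    proof -
      have "assignment H.U (\<lambda>x. (0, s x))"
        using that by (simp add: assignment_cog assignment_uw)
      with elem that(1) have "sat H.U (\<lambda>x. (0, s x)) (ogz_formula \<phi>) \<longleftrightarrow>
          sat H'.U (\<lambda>x. (0, s x)) (ogz_formula \<phi>)"
        using ogz_formula_wf by (auto simp: elem_substructure_def)
      with that M[OF that(2)] show ?thesis
        by (simp add: H.sat_ogz_formula H'.sat_ogz_formula)
    qed
    then show "elem_substructure L_c H.M H'.M"
      using sub by (simp add: elem_substructure_def)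
  qed
qed

theorem theorem4p1:
  fixes G :: "'a monoid" and R :: "'a \<Rightarrow> 'a \<Rightarrow> 'a \<Rightarrow> bool"
    and G' :: "'b monoid" and R' :: "'b \<Rightarrow> 'b \<Rightarrow> 'b \<Rightarrow> bool"
    and H H' :: "'c monoid" and S S' :: "'c \<Rightarrow> 'c \<Rightarrow> 'c \<Rightarrow> bool"
  shows
    "(cyclically_ordered_group G R \<and> cyclically_ordered_group G' R' \<longrightarrow>
        (elem_equiv L_c (cog_structure G R) (cog_structure G' R') \<longleftrightarrow>
         elem_equiv L_ogz (uw_structure G R) (uw_structure G' R')))
     \<and>
     (cyclically_ordered_group H S \<and> cyclically_ordered_group H' S' \<and>
      substructure L_c (cog_structure H S) (cog_structure H' S') \<longrightarrow>
        substructure L_ogz (uw_structure H S) (uw_structure H' S') \<and> uw_z H = uw_z H' \<and>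
        (elem_substructure L_c (cog_structure H S) (cog_structure H' S') \<longleftrightarrow>
         elem_substructure L_ogz (uw_structure H S) (uw_structure H' S')))"
  using uw_elem_equiv[of G R G' R'] cog_elem_equiv[of G R G' R'] uw_z_cong[of H S H' S']
    uw_substructure[of H S H' S'] uw_elem_substructure_iff[of H S H' S']
  by blast

end
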